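(* Let $G$ and $H$ be Polish groups and let $B\subseteq G\times H$ be a Borel set. Consider the conditions: (1) there exist a Haar null set $E\subseteq H$ and a Borel probability measure $\mu$ on $G$ such that every $h\in H\setminus E$ and every $g_1,g_2\in G$ satisfy $\mu(g_1B^hg_2)=0$; (2) $B$ is Haar null in the group $G\times H$; (3) there exists a Haar null set $E\subseteq H$ such that for every $h\in H\setminus E$ the section $B^h$ has Haar measure zero in $G$. Then (1) implies (2) (for arbitrary Polish $G$). If moreover $G$ is locally compact, then (1), (2) and (3) are all equivalent.
   Context: A Polish group is a topological group whose topology is separable and completely metrizable; $G\times H$ carries the product group structure and topology. A set $A$ in a Polish group $\Gamma$ is Haar null if there are a Borel set $B'\supseteq A$ and a Borel probability measure $\nu$ on $\Gamma$ with $\nu(xB'y)=0$ for all $x,y\in\Gamma$. For $h\in H$, $B^h=\{g\in G:(g,h)\in B\}$. In a locally compact group $G$, a set has Haar measure zero if it is contained in a Borel set of measure zero for a (any) left Haar measure on $G$ (equivalently for any right Haar measure). *)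

theory Defs
  imports "HOL-Analysis.Analysis" "HOL-Probability.Probability"
begin

definition polish_group :: "('a::topological_space \<Rightarrow> 'a \<Rightarrow> 'a) \<Rightarrow> ('a \<Rightarrow> 'a) \<Rightarrow> 'a \<Rightarrow> bool" where
  "polish_group m i e \<longleftrightarrow>
     (\<forall>x y z. m (m x y) z = m x (m y z)) \<and>
     (\<forall>x. m e x = x \<and> m x e = x) \<and>
     (\<forall>x. m (i x) x = e \<and> m x (i x) = e) \<and>
     continuous_on UNIV (\<lambda>p. m (fst p) (snd p)) \<and>
     continuous_on UNIV i \<and>
     separable_space (euclidean :: 'a topology) \<and>
     completely_metrizable_space (euclidean :: 'a topology)"

definition haar_null :: "('a::topological_space \<Rightarrow> 'a \<Rightarrow> 'a) \<Rightarrow> 'a set \<Rightarrow> bool" where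
  "haar_null m A \<longleftrightarrow>
     (\<exists>B'. B' \<in> sets borel \<and> A \<subseteq> B' \<and>
        (\<exists>\<nu>. prob_space \<nu> \<and> sets \<nu> = sets borel \<and>
             (\<forall>x y. emeasure \<nu> ((\<lambda>z. m (m x z) y) ` B') = 0)))"

definition left_haar_measure :: "('a::topological_space \<Rightarrow> 'a \<Rightarrow> 'a) \<Rightarrow> 'a measure \<Rightarrow> bool" where
  "left_haar_measure m \<mu> \<longleftrightarrow>
     sets \<mu> = sets borel \<and>
     (\<forall>K. compact K \<longrightarrow> emeasure \<mu> K < \<infinity>) \<and>
     (\<forall>A\<in>sets borel. emeasure \<mu> A = (INF U\<in>{U. open U \<and> A \<subseteq> U}. emeasure \<mu> U)) \<and>
     (\<forall>U. open U \<longrightarrow> emeasure \<mu> U = (SUP K\<in>{K. compact K \<and> K \<subseteq> U}. emeasure \<mu> K)) \<and>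
     emeasure \<mu> UNIV \<noteq> 0 \<and>
     (\<forall>g. \<forall>A\<in>sets borel. emeasure \<mu> ((m g) ` A) = emeasure \<mu> A)"

definition haar_measure_zero :: "('a::topological_space \<Rightarrow> 'a \<Rightarrow> 'a) \<Rightarrow> 'a set \<Rightarrow> bool" where
  "haar_measure_zero m A \<longleftrightarrow>
     (\<exists>\<mu>. left_haar_measure m \<mu> \<and> (\<exists>B\<in>sets borel. A \<subseteq> B \<and> emeasure \<mu> B = 0))"

definition prod_mult :: "('a \<Rightarrow> 'a \<Rightarrow> 'a) \<Rightarrow> ('b \<Rightarrow> 'b \<Rightarrow> 'b) \<Rightarrow> 'a \<times> 'b \<Rightarrow> 'a \<times> 'b \<Rightarrow> 'a \<times> 'b" where
  "prod_mult mG mH p q = (mG (fst p) (fst q), mH (snd p) (snd q))"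

definition hsection :: "('a \<times> 'b) set \<Rightarrow> 'b \<Rightarrow> 'a set" where
  "hsection B h = {g. (g, h) \<in> B}"

end

theory Submission
  imports Defs
begin

text \<open>
  If (1) holds with $\mu$ on $G$ and if $\nu$ witnesses that $E$ is Haar null in $H$, then
  $\mu \times \nu$ witnesses that $B$ is Haar null, by Fubini.

  Let $G$ be locally compact with left Haar measure $\lambda$. If $\nu$ witnesses that a Borel set
  $B' \supseteq B$ is Haar null in $G \times H$, then the projection of $\nu$ to $H$ witnesses that
  $E = \{h : \lambda(B'^h) > 0\}$ is Haar null: integrate $\nu((1,h_1) B' (g^{-1},h_2)) = 0$ over
  $g$ with respect to $\lambda$ and exchange the integrals; the inner integral becomes
  $\lambda(a^{-1} B'^{h'}) = \lambda(B'^{h'})$ with $h' = h_1^{-1} h h_2^{-1}$. This gives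
  (2) $\Rightarrow$ (3). For (3) $\Rightarrow$ (1), take for $\mu$ the normalised restriction of
  $\lambda$ to a compact set of positive measure; all left Haar measures have the same null sets,
  and these are invariant under inversion and under two-sided translation.

  Haar measure itself is obtained from covering numbers: a cluster point (Tychonoff) of the
  normalised covering numbers $(K : U) / (C : U)$ for $U \to 1$ is an invariant content on the
  compact sets, and its Caratheodory extension is regular by construction.
\<close>

subsection \<open>Second countable spaces\<close>

text \<open>The balls of radius 1/(n+1) about the points of a countable dense set form a base: if
  1/(n+1) < r/2 and the centre is that close to x, the ball contains x and stays inside the ball of
  radius r about x.\<close>

lemma separable_metrizable_imp_second_countable:
  assumes "separable_space X" "metrizable_space X"
  shows "second_countable X"
proof -
  obtain M d where "Metric_space M d" and X: "X = Metric_space.mtopology M d"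
    using assms(2) by (auto simp: metrizable_space_def)
  interpret Metric_space M d by fact
  obtain C where C: "countable C" "C \<subseteq> M" "mtopology closure_of C = M"
    using assms(1) by (auto simp: X separable_space_def)
  define \<B> where "\<B> = (\<lambda>(c, n). mball c (inverse (real (Suc n)))) ` (C \<times> UNIV)"
  show ?thesis
    unfolding second_countable_def
  proof (intro exI conjI allI impI)
    show "countable \<B>" using C(1) by (auto simp: \<B>_def)
    show "\<forall>V\<in>\<B>. openin X V" by (auto simp: \<B>_def X openin_mball)
    fix U x assume "openin X U \<and> x \<in> U"
    then obtain r where x: "x \<in> M" and r: "r > 0" "mball x r \<subseteq> U"
      unfolding X by (meson openin_mtopology subsetD)
    obtain n where n: "inverse (real (Suc n)) < r / 2"
      using reals_Archimedean[of "r / 2"] r by auto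
    have "x \<in> mtopology closure_of C" using C(3) x by simp
    moreover have "0 < inverse (real (Suc n))" by simp
    ultimately obtain c where c: "c \<in> C" "c \<in> mball x (inverse (real (Suc n)))"
      unfolding metric_closure_of by blast
    have "x \<in> mball c (inverse (real (Suc n)))" using c x commute[of x c] by simp
    moreover have "mball c (inverse (real (Suc n))) \<subseteq> mball x r"
    proof
      fix z assume z: "z \<in> mball c (inverse (real (Suc n)))"
      have "d x z \<le> d x c + d c z" using z c x by (intro triangle) auto
      also have "\<dots> < r" using z c n by auto
      finally show "z \<in> mball x r" using z x by auto
    qed
    moreover have "mball c (inverse (real (Suc n))) \<in> \<B>"
      unfolding \<B>_def by (rule image_eqI[of _ _ "(c, n)"]) (simp_all add: c(1))
    ultimately show "\<exists>V\<in>\<B>. x \<in> V \<and> V \<subseteq> U"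
      using subset_trans[OF _ r(2)] by (intro bexI conjI)
  qed
qed

lemma second_countable_euclideanD:
  assumes "second_countable (euclidean :: 'a::topological_space topology)"
  shows "\<exists>\<B>. countable \<B> \<and> (\<forall>V\<in>\<B>. open V) \<and>
    (\<forall>U (x::'a). open U \<longrightarrow> x \<in> U \<longrightarrow> (\<exists>V\<in>\<B>. x \<in> V \<and> V \<subseteq> U))"
  using assms by (simp add: second_countable_def imp_conjL)

lemma sets_borel_eq_sigma_sets: "sets borel = sigma_sets UNIV {S. open S}"
  by (simp add: borel_def)

text \<open>Continuity of the projections makes measurable rectangles Borel in the product;
  conversely, an open set is the union of the countably many basic rectangles inside it. This lets
  Fubini be applied to Borel sets of the product topology.\<close>

lemma sets_borel_pair:
  assumes a: "second_countable (euclidean :: 'a::topological_space topology)"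
    and b: "second_countable (euclidean :: 'b::topological_space topology)"
  shows "sets (borel \<Otimes>\<^sub>M borel :: ('a \<times> 'b) measure) = sets borel"
proof
  have "A \<times> C \<in> sets borel" if "A \<in> sets borel" "C \<in> sets borel" for A :: "'a set" and C :: "'b set"
  proof -
    have "fst \<in> borel_measurable (borel :: ('a \<times> 'b) measure)"
      "snd \<in> borel_measurable (borel :: ('a \<times> 'b) measure)"
      by (intro borel_measurable_continuous_onI continuous_intros)+
    then have "fst -` A \<inter> space borel \<inter> (snd -` C \<inter> space borel) \<in> sets (borel :: ('a \<times> 'b) measure)"
      using that by (intro sets.Int measurable_sets)
    also have "fst -` A \<inter> space borel \<inter> (snd -` C \<inter> space borel) = A \<times> C" by auto
    finally show ?thesis .
  qed
  then show "sets (borel \<Otimes>\<^sub>M borel :: ('a \<times> 'b) measure) \<subseteq> sets borel"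
    unfolding sets_pair_measure
    using sets.sigma_sets_subset[of "{a \<times> b |a b. a \<in> sets borel \<and> b \<in> sets borel}" "borel :: ('a \<times> 'b) measure"]
    by auto
next
  obtain \<A> :: "'a set set" where A: "countable \<A>" "\<forall>V\<in>\<A>. open V"
      "\<forall>U x. open U \<longrightarrow> x \<in> U \<longrightarrow> (\<exists>V\<in>\<A>. x \<in> V \<and> V \<subseteq> U)"
    using second_countable_euclideanD[OF a] by (elim exE conjE) (rule that)
  obtain \<B> :: "'b set set" where B: "countable \<B>" "\<forall>V\<in>\<B>. open V"
      "\<forall>U x. open U \<longrightarrow> x \<in> U \<longrightarrow> (\<exists>V\<in>\<B>. x \<in> V \<and> V \<subseteq> U)"
    using second_countable_euclideanD[OF b] by (elim exE conjE) (rule that)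
  have "S \<in> sets (borel \<Otimes>\<^sub>M borel)" if S: "open S" for S :: "('a \<times> 'b) set"
  proof -
    define I where "I = {p \<in> \<A> \<times> \<B>. fst p \<times> snd p \<subseteq> S}"
    have "I \<subseteq> \<A> \<times> \<B>" by (auto simp: I_def)
    then have "countable I" by (rule countable_subset) (use A(1) B(1) in simp)
    moreover have "S = (\<Union>p\<in>I. fst p \<times> snd p)"
    proof
      show "S \<subseteq> (\<Union>p\<in>I. fst p \<times> snd p)"
      proof
        fix x assume "x \<in> S"
        obtain P Q where PQ: "open P" "open Q" "x \<in> P \<times> Q" "P \<times> Q \<subseteq> S"
          by (rule open_prod_elim[OF S \<open>x \<in> S\<close>])
        obtain V where "V \<in> \<A>" "fst x \<in> V" "V \<subseteq> P" using A(3)[rule_format, OF PQ(1), of "fst x"] PQ(3) by auto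
        moreover obtain W where "W \<in> \<B>" "snd x \<in> W" "W \<subseteq> Q" using B(3)[rule_format, OF PQ(2), of "snd x"] PQ(3) by auto
        ultimately have "(V, W) \<in> I" "x \<in> V \<times> W" using PQ(4) by (auto simp: I_def mem_Times_iff)
        then show "x \<in> (\<Union>p\<in>I. fst p \<times> snd p)"
          by (intro UN_I[of "(V, W)"]) simp_all
      qed
      show "(\<Union>p\<in>I. fst p \<times> snd p) \<subseteq> S"
        unfolding I_def by (intro UN_least) simp
    qed
    moreover have "(\<Union>p\<in>I. fst p \<times> snd p) \<in> sets (borel \<Otimes>\<^sub>M borel)"
    proof (rule sets.countable_UN''[OF \<open>countable I\<close>])
      fix p assume "p \<in> I"
      then have "open (fst p)" "open (snd p)" using A(2) B(2) by (simp_all add: I_def mem_Times_iff)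
      then show "fst p \<times> snd p \<in> sets (borel \<Otimes>\<^sub>M borel)" by (intro pair_measureI borel_open)
    qed
    ultimately show ?thesis by simp
  qed
  then have "{S. open S} \<subseteq> sets (borel \<Otimes>\<^sub>M borel :: ('a \<times> 'b) measure)" by blast
  from sets.sigma_sets_subset[OF this]
  show "sets borel \<subseteq> sets (borel \<Otimes>\<^sub>M borel :: ('a \<times> 'b) measure)"
    by (simp only: sets_borel_eq_sigma_sets space_pair_measure space_borel UNIV_Times_UNIV)
qed

subsection \<open>Contents on compact sets\<close>

text \<open>The last two axioms together give additivity on disjoint compact sets. Infinite values
  are allowed; finiteness on compact sets is added in the existence proof for Haar measure.\<close>

locale compact_content =
  fixes c :: "'a::topological_space set \<Rightarrow> ennreal"
  assumes Hausdorff: "Hausdorff_space (euclidean :: 'a topology)"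
    and content_empty: "c {} = 0"
    and content_mono: "\<And>K L. compact K \<Longrightarrow> compact L \<Longrightarrow> K \<subseteq> L \<Longrightarrow> c K \<le> c L"
    and content_subadditive: "\<And>K L. compact K \<Longrightarrow> compact L \<Longrightarrow> c (K \<union> L) \<le> c K + c L"
    and content_superadditive:
      "\<And>K L. compact K \<Longrightarrow> compact L \<Longrightarrow> K \<inter> L = {} \<Longrightarrow> c K + c L \<le> c (K \<union> L)"
begin

definition inner :: "'a set \<Rightarrow> ennreal" where
  "inner U = (SUP K\<in>{K. compact K \<and> K \<subseteq> U}. c K)"

text \<open>On open sets this agrees with \<open>inner\<close> (see \<open>outer_open\<close>),
  which prepares both regularity properties of a Haar measure: outer on Borel sets, inner on open
  sets.\<close>

definition outer :: "'a set \<Rightarrow> ennreal" where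
  "outer A = (INF U\<in>{U. open U \<and> A \<subseteq> U}. inner U)"

lemma compact_is_closed: "compact K \<Longrightarrow> closed (K :: 'a set)"
  using compactin_imp_closedin[OF Hausdorff, of K] by simp

lemma compact_Diff_open: "compact K \<Longrightarrow> open U \<Longrightarrow> compact (K - U :: 'a set)"
  unfolding Diff_eq by (intro compact_Int_closed) auto

text \<open>The compact sets \<open>K - U\<close> and \<open>K - V\<close> are disjoint, hence have
  disjoint open neighbourhoods P and Q. Removing P and Q from K leaves the two pieces.\<close>

lemma compact_split:
  fixes K :: "'a set"
  assumes K: "compact K" "K \<subseteq> U \<union> V" and UV: "open U" "open V"
  obtains K1 K2 where "compact K1" "compact K2" "K1 \<subseteq> U" "K2 \<subseteq> V" "K = K1 \<union> K2"
proof -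
  have "compactin euclidean (K - U)" "compactin euclidean (K - V)" "disjnt (K - U) (K - V)"
    using K UV by (auto simp: compact_Diff_open disjnt_def)
  then obtain P Q where PQ: "openin euclidean P" "openin euclidean Q" "K - U \<subseteq> P" "K - V \<subseteq> Q" "disjnt P Q"
    using Hausdorff_space_compact_separation[OF Hausdorff] by metis
  show thesis
  proof (rule that)
    show "compact (K - P)" "compact (K - Q)" using K PQ by (auto intro: compact_Diff_open)
    show "K - P \<subseteq> U" "K - Q \<subseteq> V" "K = K - P \<union> (K - Q)" using PQ by (auto simp: disjnt_def)
  qed
qed

lemma content_le_inner: "compact K \<Longrightarrow> K \<subseteq> U \<Longrightarrow> c K \<le> inner U"
  unfolding inner_def by (rule SUP_upper) simp

lemma inner_least: "(\<And>K. compact K \<Longrightarrow> K \<subseteq> U \<Longrightarrow> c K \<le> x) \<Longrightarrow> inner U \<le> x"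
  unfolding inner_def by (rule SUP_least) simp

lemma inner_mono: "U \<subseteq> V \<Longrightarrow> inner U \<le> inner V"
  by (rule inner_least) (auto intro: content_le_inner)

lemma inner_empty: "inner {} = 0"
  using inner_least[of "{}" 0] by (simp add: content_empty)

lemma inner_Un: assumes "open U" "open V" shows "inner (U \<union> V) \<le> inner U + inner V"
proof (rule inner_least)
  fix K assume "compact K" "K \<subseteq> U \<union> V"
  then obtain K1 K2 where K: "compact K1" "compact K2" "K1 \<subseteq> U" "K2 \<subseteq> V" "K = K1 \<union> K2"
    using compact_split[OF _ _ assms] by metis
  have "c K \<le> c K1 + c K2" unfolding K(5) by (rule content_subadditive[OF K(1,2)])
  also have "\<dots> \<le> inner U + inner V" by (intro add_mono content_le_inner K)
  finally show "c K \<le> inner U + inner V" .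
qed

lemma inner_UN_finite:
  assumes "\<And>n. open (U n)"
  shows "inner (\<Union>k<n::nat. U k) \<le> (\<Sum>k<n. inner (U k))"
proof (induction n)
  case (Suc n)
  have "inner (\<Union>k<Suc n. U k) = inner ((\<Union>k<n. U k) \<union> U n)"
    by (simp add: lessThan_Suc Un_commute)
  also have "\<dots> \<le> inner (\<Union>k<n. U k) + inner (U n)" using assms by (intro inner_Un open_UN) auto
  also have "\<dots> \<le> (\<Sum>k<Suc n. inner (U k))" using Suc.IH by (simp add: add_right_mono)
  finally show ?case .
qed (simp add: inner_empty)

text \<open>A compact subset of the union is covered by finitely many of the open sets, so finite
  subadditivity suffices.\<close>

lemma inner_UN:
  assumes U: "\<And>n. open (U n)"
  shows "inner (\<Union>n::nat. U n) \<le> (\<Sum>n. inner (U n))"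
proof (rule inner_least)
  fix K assume "compact K" "K \<subseteq> (\<Union>n. U n)"
  then obtain F where F: "finite F" "K \<subseteq> (\<Union>n\<in>F. U n)"
    using compactE_image[of K UNIV U] U by auto
  obtain n where n: "F \<subseteq> {..<n}" using F(1) finite_nat_iff_bounded by blast
  have "c K \<le> inner (\<Union>k<n. U k)" using F(2) n \<open>compact K\<close> by (intro content_le_inner) blast+
  also have "\<dots> \<le> (\<Sum>k<n. inner (U k))" by (rule inner_UN_finite[OF U])
  also have "\<dots> \<le> (\<Sum>k. inner (U k))" by (rule sum_le_suminf) auto
  finally show "c K \<le> (\<Sum>n. inner (U n))" .
qed

section \<open>The outer measure of a content and its Caratheodory extension\<close>

lemma outer_le: "open U \<Longrightarrow> A \<subseteq> U \<Longrightarrow> outer A \<le> inner U"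
  unfolding outer_def by (rule INF_lower) simp

lemma outer_greatest: "(\<And>U. open U \<Longrightarrow> A \<subseteq> U \<Longrightarrow> x \<le> inner U) \<Longrightarrow> x \<le> outer A"
  unfolding outer_def by (rule INF_greatest) simp

lemma outer_open: "open U \<Longrightarrow> outer U = inner U"
  by (intro antisym outer_le outer_greatest inner_mono) auto

lemma outer_mono: "A \<subseteq> B \<Longrightarrow> outer A \<le> outer B"
  by (rule outer_greatest) (auto intro: outer_le)

lemma content_le_outer: "compact K \<Longrightarrow> c K \<le> outer K"
  by (rule outer_greatest) (rule content_le_inner)

lemma outer_UN: "outer (\<Union>n::nat. A n) \<le> (\<Sum>n. outer (A n))"
proof (rule ennreal_le_epsilon)
  fix e :: real assume e: "0 < e" and fin: "(\<Sum>n. outer (A n)) < top"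
  \<comment> \<open>The n-th set gets the share e/2^(n+1) of the error. Finiteness of the sum makes
    each \<open>outer (A n)\<close> finite, which gives the strict inequality needed to pick
    U.\<close>
  have "\<exists>U. open U \<and> A n \<subseteq> U \<and> inner U \<le> outer (A n) + e * (1/2)^Suc n" for n
  proof -
    have "outer (A n) < outer (A n) + e * (1/2)^Suc n"
      using fin e by (auto simp add: less_top dest!: ennreal_suminf_lessD)
    then have "(INF U\<in>{U. open U \<and> A n \<subseteq> U}. inner U) < outer (A n) + e * (1/2)^Suc n"
      by (simp add: outer_def)
    then show ?thesis unfolding INF_less_iff by (auto intro: less_imp_le)
  qed
  then obtain U where U: "\<And>n. open (U n)" "\<And>n. A n \<subseteq> U n"
      "\<And>n. inner (U n) \<le> outer (A n) + e * (1/2)^Suc n"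
    by metis
  have "outer (\<Union>n. A n) \<le> inner (\<Union>n. U n)" using U(1,2) by (intro outer_le) auto
  also have "\<dots> \<le> (\<Sum>n. inner (U n))" by (rule inner_UN[OF U(1)])
  also have "\<dots> \<le> (\<Sum>n. outer (A n) + e * (1/2)^Suc n)"
    by (intro suminf_le U(3)) auto
  also have "\<dots> = (\<Sum>n. outer (A n)) + (\<Sum>n. ennreal e * ennreal ((1/2) ^ Suc n))"
    using e by (subst suminf_add[symmetric])
      (auto simp del: ennreal_suminf_cmult simp add: ennreal_mult[symmetric])
  also have "\<dots> = (\<Sum>n. outer (A n)) + e"
    unfolding ennreal_suminf_cmult
    by (subst suminf_ennreal_eq[OF zero_le_power power_half_series]) auto
  finally show "outer (\<Union>n. A n) \<le> (\<Sum>n. outer (A n)) + e" .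
qed

lemma outer_measure_space_outer: "outer_measure_space UNIV outer"
  unfolding outer_measure_space_def
proof (intro conjI)
  show "positive UNIV outer"
    by (simp add: positive_def outer_open[of "{}"] inner_empty)
  show "increasing UNIV outer" by (simp add: increasing_def outer_mono)
  show "countably_subadditive UNIV outer" by (simp add: countably_subadditive_def outer_UN)
qed

lemma outer_Un: "outer (A \<union> B) \<le> outer A + outer B"
proof -
  interpret ring_of_sets UNIV "UNIV :: 'a set set"
    using sigma_algebra_Pow[of "UNIV :: 'a set"] by (simp add: sigma_algebra_iff2 ring_of_sets_iff)
  have "subadditive UNIV outer"
    using outer_measure_space_outer by (intro countably_subadditive_subadditive) (auto simp: outer_measure_space_def)
  \<comment> \<open>\<open>subadditive\<close> speaks of disjoint sets only, hence the detour
    through \<open>B - A\<close>.\<close>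
  moreover have "outer (A \<union> B) = outer (A \<union> (B - A))" by simp
  ultimately have "outer (A \<union> B) \<le> outer A + outer (B - A)"
    unfolding subadditive_def by (metis Diff_disjoint UNIV_I)
  also have "\<dots> \<le> outer A + outer B" by (intro add_mono outer_mono) auto
  finally show ?thesis .
qed

text \<open>Exhaust \<open>V \<inter> U\<close> by compact K. The open set \<open>V - K\<close>
  contains \<open>V - U\<close> and is exhausted by compact L, which are disjoint from K, so
  superadditivity of the content applies to the pair.\<close>

lemma inner_split_open:
  assumes U: "open U" and V: "open V"
  shows "inner (V \<inter> U) + outer (V - U) \<le> inner V"
proof -
  have *: "c K + outer (V - U) \<le> inner V" if K: "compact K" "K \<subseteq> V \<inter> U" for K
  proof -
    have "outer (V - U) \<le> inner (V - K)"
      using K V by (intro outer_le open_Diff compact_is_closed) auto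
    then have "c K + outer (V - U) \<le> c K + inner (V - K)" by (rule add_left_mono)
    also have "\<dots> = (SUP L\<in>{L. compact L \<and> L \<subseteq> V - K}. c K + c L)"
      unfolding inner_def by (rule ennreal_SUP_add_right) (auto intro: exI[of _ "{}"])
    also have "\<dots> \<le> inner V"
    proof (rule SUP_least)
      fix L assume L: "L \<in> {L. compact L \<and> L \<subseteq> V - K}"
      then have "c K + c L \<le> c (K \<union> L)" using K by (intro content_superadditive) auto
      also have "\<dots> \<le> inner V" using K L by (intro content_le_inner) auto
      finally show "c K + c L \<le> inner V" .
    qed
    finally show ?thesis .
  qed
  have "inner (V \<inter> U) + outer (V - U) = (SUP K\<in>{K. compact K \<and> K \<subseteq> V \<inter> U}. c K + outer (V - U))"
    unfolding inner_def by (rule ennreal_SUP_add_left[symmetric]) (auto intro: exI[of _ "{}"])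
  also have "\<dots> \<le> inner V" using * by (intro SUP_least) auto
  finally show ?thesis .
qed

text \<open>Caratheodory's condition for an arbitrary A is tested on the open sets V containing A,
  where it reduces to \<open>inner_split_open\<close>.\<close>

lemma open_lambda_system: assumes U: "open U" shows "U \<in> lambda_system UNIV UNIV outer"
proof -
  have "outer (U \<inter> A) + outer ((UNIV - U) \<inter> A) = outer A" for A
  proof (rule antisym)
    show "outer (U \<inter> A) + outer ((UNIV - U) \<inter> A) \<le> outer A"
    proof (rule outer_greatest)
      fix V assume V: "open V" "A \<subseteq> V"
      have "outer (U \<inter> A) \<le> inner (V \<inter> U)" using U V by (intro outer_le) auto
      moreover have "outer ((UNIV - U) \<inter> A) \<le> outer (V - U)" using V by (intro outer_mono) auto
      ultimately have "outer (U \<inter> A) + outer ((UNIV - U) \<inter> A) \<le> inner (V \<inter> U) + outer (V - U)"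
        by (rule add_mono)
      also have "\<dots> \<le> inner V" by (rule inner_split_open[OF U V(1)])
      finally show "outer (U \<inter> A) + outer ((UNIV - U) \<inter> A) \<le> inner V" .
    qed
    have "A = U \<inter> A \<union> (UNIV - U) \<inter> A" by auto
    then show "outer A \<le> outer (U \<inter> A) + outer ((UNIV - U) \<inter> A)" using outer_Un by metis
  qed
  then show ?thesis by (simp add: lambda_system_def)
qed

definition content_measure :: "'a measure" where
  "content_measure = measure_of UNIV (sets borel) outer"

lemma sets_content_measure [simp]: "sets content_measure = sets borel"
  unfolding content_measure_def using sets.sets_measure_of_eq[of "borel :: 'a measure"] by simp

text \<open>\<open>outer\<close> is a measure on the Caratheodory measurable sets. These form a
  sigma-algebra containing the open sets, hence the Borel sets, and the measure restricts.\<close>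

lemma emeasure_content_measure:
  assumes "A \<in> sets borel" shows "emeasure content_measure A = outer A"
proof -
  let ?L = "lambda_system UNIV UNIV outer"
  have "sigma_algebra UNIV (UNIV :: 'a set set)" using sigma_algebra_Pow[of "UNIV :: 'a set"] by simp
  then have L: "measure_space UNIV ?L outer"
    using outer_measure_space_outer by (intro sigma_algebra.caratheodory_lemma)
  then interpret L: sigma_algebra UNIV ?L by (simp add: measure_space_def)
  have "sets borel \<subseteq> ?L"
    unfolding sets_borel_eq_sigma_sets by (rule L.sigma_sets_subset) (auto intro: open_lambda_system)
  moreover have "sigma_algebra UNIV (sets (borel :: 'a measure))"
    using sets.sigma_algebra_axioms[of "borel :: 'a measure"] by simp
  ultimately have "measure_space UNIV (sets borel) outer" by (rule measure_down[OF L, rotated])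
  then show ?thesis
    unfolding content_measure_def measure_space_def using assms by (intro emeasure_measure_of_sigma) auto
qed

end

subsection \<open>Polish groups\<close>

locale polish_topological_group =
  fixes m :: "'a::topological_space \<Rightarrow> 'a \<Rightarrow> 'a" and i :: "'a \<Rightarrow> 'a" and e :: 'a
  assumes polish: "polish_group m i e"
begin

sublocale group m e i
  using polish by unfold_locales (auto simp: polish_group_def)

lemma cancel [simp]: "m (i x) (m x y) = y" "m x (m (i x) y) = y" "m (m y x) (i x) = y" "m (m y (i x)) x = y"
  by (metis assoc group_left_neutral left_inverse right_inverse right_neutral)+

lemma continuous_on_mult [continuous_intros]:
  assumes "continuous_on S f" "continuous_on S g"
  shows "continuous_on S (\<lambda>x. m (f x) (g x))"
proof -
  have "continuous_on UNIV (\<lambda>p. m (fst p) (snd p))" using polish by (simp add: polish_group_def)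
  from continuous_on_compose2[OF this continuous_on_Pair[OF assms]] show ?thesis by simp
qed

lemma continuous_on_inverse [continuous_intros]:
  assumes "continuous_on S f"
  shows "continuous_on S (\<lambda>x. i (f x))"
proof -
  have "continuous_on UNIV i" using polish by (simp add: polish_group_def)
  from continuous_on_compose2[OF this assms] show ?thesis by simp
qed

text \<open>Translates are turned into preimages, so that openness and measurability follow from
  continuity and measurability of the translations.\<close>

lemma image_mult: "m g ` A = m (i g) -` A"
  by (auto simp: image_iff) (metis cancel(2))

lemma translate_cancel [simp]:
  "m (m (i x) (m (m x z) y)) (i y) = z" "m (m x (m (m (i x) z) (i y))) y = z"
  by (simp_all add: assoc)

lemma image_mult_mult: "(\<lambda>z. m (m x z) y) ` A = (\<lambda>z. m (m (i x) z) (i y)) -` A"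
proof
  show "(\<lambda>z. m (m (i x) z) (i y)) -` A \<subseteq> (\<lambda>z. m (m x z) y) ` A"
  proof
    fix z assume "z \<in> (\<lambda>z. m (m (i x) z) (i y)) -` A"
    then have "m (m x (m (m (i x) z) (i y))) y \<in> (\<lambda>z. m (m x z) y) ` A"
      by (intro imageI) simp
    then show "z \<in> (\<lambda>z. m (m x z) y) ` A" by simp
  qed
qed auto

lemma metrizable: "metrizable_space (euclidean :: 'a topology)"
  using polish by (simp add: polish_group_def completely_metrizable_imp_metrizable_space)

lemma Hausdorff: "Hausdorff_space (euclidean :: 'a topology)"
  by (rule metrizable_imp_Hausdorff_space[OF metrizable])

lemma second_countable: "second_countable (euclidean :: 'a topology)"
  using polish metrizable by (simp add: polish_group_def separable_metrizable_imp_second_countable)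

lemma compact_closed: "compact K \<Longrightarrow> closed (K :: 'a set)"
  using compactin_imp_closedin[OF Hausdorff, of K] by simp

text \<open>Continuity gives measurability for the Borel sets of the product topology;
  \<open>sets_borel_pair\<close> converts this to the product sigma-algebra, where pairing is
  measurable.\<close>

lemma measurable_mult [measurable (raw)]:
  assumes [measurable]: "f \<in> borel_measurable M" "g \<in> borel_measurable M"
  shows "(\<lambda>x. m (f x) (g x)) \<in> borel_measurable M"
proof -
  have "(\<lambda>p. m (fst p) (snd p)) \<in> borel_measurable borel"
    by (intro borel_measurable_continuous_onI continuous_intros)
  then have "(\<lambda>p. m (fst p) (snd p)) \<in> borel_measurable (borel \<Otimes>\<^sub>M borel)"
    by (subst measurable_cong_sets[OF sets_borel_pair[OF second_countable second_countable] refl])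
  from measurable_compose[OF measurable_Pair[OF assms] this] show ?thesis by simp
qed

lemma measurable_inverse [measurable]: "i \<in> borel_measurable borel"
  by (intro borel_measurable_continuous_onI continuous_intros)

lemma borel_image_mult [measurable]:
  assumes "A \<in> sets borel" shows "m g ` A \<in> sets borel"
proof -
  have "m (i g) \<in> borel_measurable borel" by measurable
  from measurable_sets[OF this assms] show ?thesis by (simp add: image_mult)
qed

end

subsection \<open>Covering numbers\<close>

context polish_topological_group
begin

text \<open>This is (K : U) of Haar's construction. It is a genuine minimum when K is compact and U
  is in \<open>unit_nhds\<close> (see \<open>cover_number_attained\<close>); if there is no finite
  cover, \<open>LEAST\<close> is unspecified.\<close>

definition cover_number :: "'a set \<Rightarrow> 'a set \<Rightarrow> nat" where
  "cover_number K U = (LEAST n. \<exists>F. finite F \<and> card F = n \<and> K \<subseteq> (\<Union>g\<in>F. m g ` U))"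

definition unit_nhds :: "'a set set" where
  "unit_nhds = {U. open U \<and> e \<in> U}"

lemma open_translate: "open U \<Longrightarrow> open (m g ` U)"
  unfolding image_mult by (rule open_vimage) (auto intro!: continuous_intros)

lemma compact_translate: "compact K \<Longrightarrow> compact (m g ` K)"
  by (rule compact_continuous_image) (auto intro!: continuous_intros)

lemma cover_number_le: "finite F \<Longrightarrow> K \<subseteq> (\<Union>g\<in>F. m g ` U) \<Longrightarrow> cover_number K U \<le> card F"
  unfolding cover_number_def by (rule Least_le) auto

lemma cover_number_attained:
  assumes K: "compact K" and U: "U \<in> unit_nhds"
  obtains F where "finite F" "card F = cover_number K U" "K \<subseteq> (\<Union>g\<in>F. m g ` U)"
proof -
  have "K \<subseteq> (\<Union>g\<in>K. m g ` U)"
  proof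
    fix x assume "x \<in> K"
    moreover have "m x e \<in> m x ` U" using U by (intro imageI) (simp add: unit_nhds_def)
    ultimately show "x \<in> (\<Union>g\<in>K. m g ` U)" by auto
  qed
  then obtain F where F: "F \<subseteq> K" "finite F" "K \<subseteq> (\<Union>g\<in>F. m g ` U)"
    using U open_translate by (auto simp: unit_nhds_def intro: compactE_image[OF K, of K "\<lambda>g. m g ` U"])
  then have "\<exists>n. \<exists>F. finite F \<and> card F = n \<and> K \<subseteq> (\<Union>g\<in>F. m g ` U)" by blast
  then have "\<exists>F. finite F \<and> card F = cover_number K U \<and> K \<subseteq> (\<Union>g\<in>F. m g ` U)"
    unfolding cover_number_def by (rule LeastI_ex)
  then show thesis using that by blast
qed

lemma cover_number_empty: "cover_number {} U = 0"
  using cover_number_le[of "{}" "{}" U] by simp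

lemma cover_number_mono:
  assumes "compact L" "K \<subseteq> L" "U \<in> unit_nhds"
  shows "cover_number K U \<le> cover_number L U"
proof -
  obtain F where F: "finite F" "card F = cover_number L U" "L \<subseteq> (\<Union>g\<in>F. m g ` U)"
    using cover_number_attained[OF assms(1,3)] .
  have "cover_number K U \<le> card F" using F assms(2) by (intro cover_number_le) auto
  then show ?thesis by (simp add: F(2))
qed

lemma cover_number_Un:
  assumes "compact K" "compact L" "U \<in> unit_nhds"
  shows "cover_number (K \<union> L) U \<le> cover_number K U + cover_number L U"
proof -
  obtain F where F: "finite F" "card F = cover_number K U" "K \<subseteq> (\<Union>g\<in>F. m g ` U)"
    using cover_number_attained[OF assms(1,3)] .
  obtain F' where F': "finite F'" "card F' = cover_number L U" "L \<subseteq> (\<Union>g\<in>F'. m g ` U)"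
    using cover_number_attained[OF assms(2,3)] .
  have "cover_number (K \<union> L) U \<le> card (F \<union> F')" using F F' by (intro cover_number_le) auto
  also have "\<dots> \<le> card F + card F'" by (rule card_Un_le)
  finally show ?thesis by (simp add: F(2) F'(2))
qed

text \<open>In an optimal cover of \<open>K \<union> L\<close>, the translates meeting K cover K and
  those meeting L cover L. By \<open>sep\<close> no translate is counted twice.\<close>

lemma cover_number_separated:
  assumes "compact K" "compact L" "U \<in> unit_nhds"
    and sep: "\<And>g. m g ` U \<inter> K = {} \<or> m g ` U \<inter> L = {}"
  shows "cover_number K U + cover_number L U \<le> cover_number (K \<union> L) U"
proof -
  obtain F where F: "finite F" "card F = cover_number (K \<union> L) U" "K \<union> L \<subseteq> (\<Union>g\<in>F. m g ` U)"
    using cover_number_attained[OF compact_Un[OF assms(1,2)] assms(3)] .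
  define P where "P = {g \<in> F. m g ` U \<inter> K \<noteq> {}}"
  define Q where "Q = {g \<in> F. m g ` U \<inter> L \<noteq> {}}"
  have fin: "finite P" "finite Q" using F(1) by (auto simp: P_def Q_def)
  have "M \<subseteq> (\<Union>g\<in>{g \<in> F. m g ` U \<inter> M \<noteq> {}}. m g ` U)" if M: "M \<subseteq> K \<union> L" for M
  proof
    fix x assume x: "x \<in> M"
    then have "x \<in> (\<Union>g\<in>F. m g ` U)" using M F(3) by (meson subsetD)
    then obtain g where g: "g \<in> F" "x \<in> m g ` U" by (rule UN_E)
    then have "m g ` U \<inter> M \<noteq> {}" using x by (metis IntI empty_iff)
    then show "x \<in> (\<Union>g\<in>{g \<in> F. m g ` U \<inter> M \<noteq> {}}. m g ` U)"
      using g by (intro UN_I[of g]) simp_all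
  qed
  then have "K \<subseteq> (\<Union>g\<in>P. m g ` U)" "L \<subseteq> (\<Union>g\<in>Q. m g ` U)"
    unfolding P_def Q_def by simp_all
  then have "cover_number K U \<le> card P" "cover_number L U \<le> card Q"
    using fin by (auto intro: cover_number_le)
  moreover have "P \<inter> Q = {}" using sep by (auto simp: P_def Q_def)
  then have "card P + card Q = card (P \<union> Q)" using fin by (simp add: card_Un_disjoint)
  moreover have "card (P \<union> Q) \<le> card F" using F(1) by (intro card_mono) (auto simp: P_def Q_def)
  ultimately show ?thesis using F(2) by linarith
qed

lemma image_mult_image: "m g ` m h ` A = m (m g h) ` A"
  by (simp add: image_image assoc)

lemma cover_number_translate_le:
  assumes "compact K" "U \<in> unit_nhds"
  shows "cover_number (m g ` K) U \<le> cover_number K U"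
proof -
  obtain F where F: "finite F" "card F = cover_number K U" "K \<subseteq> (\<Union>h\<in>F. m h ` U)"
    using cover_number_attained[OF assms] .
  have "m g ` K \<subseteq> m g ` (\<Union>h\<in>F. m h ` U)" by (rule image_mono[OF F(3)])
  also have "\<dots> = (\<Union>h\<in>m g ` F. m h ` U)" by (simp add: image_UN image_mult_image)
  finally have "cover_number (m g ` K) U \<le> card (m g ` F)" using F(1) by (intro cover_number_le) auto
  also have "\<dots> \<le> card F" by (rule card_image_le[OF F(1)])
  finally show ?thesis by (simp add: F(2))
qed

lemma cover_number_translate:
  assumes "compact K" "U \<in> unit_nhds"
  shows "cover_number (m g ` K) U = cover_number K U"
proof (rule antisym)
  have "cover_number (m (i g) ` m g ` K) U \<le> cover_number (m g ` K) U"
    by (intro cover_number_translate_le compact_translate assms)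
  then show "cover_number K U \<le> cover_number (m g ` K) U" by (simp add: image_mult_image)
qed (rule cover_number_translate_le[OF assms])

lemma cover_number_pos:
  assumes "compact K" "U \<in> unit_nhds" "K \<noteq> {}"
  shows "cover_number K U > 0"
proof -
  obtain F where F: "finite F" "card F = cover_number K U" "K \<subseteq> (\<Union>h\<in>F. m h ` U)"
    using cover_number_attained[OF assms(1,2)] .
  then have "F \<noteq> {}" using assms(3) by auto
  then show ?thesis using F(1,2) by (metis card_gt_0_iff)
qed

text \<open>Cover K by translates of W, and each of these, lying in a translate of C, by translates
  of U. The result bounds the ratio (K : U) / (C : U) by (K : W), uniformly in U.\<close>

lemma cover_number_mult:
  assumes K: "compact K" and C: "compact C" and W: "W \<in> unit_nhds" "W \<subseteq> C" and U: "U \<in> unit_nhds"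
  shows "cover_number K U \<le> cover_number K W * cover_number C U"
proof -
  obtain F where F: "finite F" "card F = cover_number K W" "K \<subseteq> (\<Union>h\<in>F. m h ` W)"
    using cover_number_attained[OF K W(1)] .
  obtain H where H: "finite H" "card H = cover_number C U" "C \<subseteq> (\<Union>h\<in>H. m h ` U)"
    using cover_number_attained[OF C U] .
  let ?P = "(\<lambda>(f, h). m f h) ` (F \<times> H)"
  note F(3)
  also have "(\<Union>f\<in>F. m f ` W) \<subseteq> (\<Union>f\<in>F. m f ` (\<Union>h\<in>H. m h ` U))"
    by (intro UN_mono image_mono subset_refl subset_trans[OF W(2) H(3)])
  also have "\<dots> = (\<Union>g\<in>?P. m g ` U)" by (auto simp: image_UN image_mult_image)
  finally have "cover_number K U \<le> card ?P" using F(1) H(1) by (intro cover_number_le) auto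
  also have "\<dots> \<le> card (F \<times> H)" using F(1) H(1) by (intro card_image_le) auto
  finally show ?thesis by (simp add: card_cartesian_product F(2) H(2))
qed

text \<open>If gv is in K and gw is in L, then v^-1 w = (gv)^-1 (gw) lies in the compact set K^-1 L,
  which omits \<open>e\<close> because K and L are disjoint. By continuity at \<open>(e, e)\<close>
  this cannot happen for v and w close to \<open>e\<close>.\<close>

lemma separating_unit_nhd:
  assumes K: "compact K" and L: "compact L" and disj: "K \<inter> L = {}"
  obtains V where "V \<in> unit_nhds" "\<And>g. m g ` V \<inter> K = {} \<or> m g ` V \<inter> L = {}"
proof -
  define C where "C = (\<lambda>p. m (i (fst p)) (snd p)) ` (K \<times> L)"
  have "compact C" unfolding C_def
    by (intro compact_continuous_image compact_Times K L continuous_intros)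
  then have "open (- C)" using compact_closed by auto
  define D where "D = (\<lambda>p. m (i (fst p)) (snd p)) -` (- C)"
  have D: "open D" unfolding D_def
    by (intro open_vimage \<open>open (- C)\<close> continuous_intros)
  have "e \<notin> C"
  proof
    assume "e \<in> C"
    then obtain k l where kl: "k \<in> K" "l \<in> L" "e = m (i k) l" by (auto simp: C_def)
    then have "k = l" by (metis cancel(2) right_neutral)
    then show False using kl(1,2) disj by blast
  qed
  then have "(e, e) \<in> D" by (simp add: D_def)
  obtain P Q where PQ: "open P" "open Q" "(e, e) \<in> P \<times> Q" "P \<times> Q \<subseteq> D"
    by (rule open_prod_elim[OF D \<open>(e, e) \<in> D\<close>])
  show thesis
  proof (rule that[of "P \<inter> Q"])
    show "P \<inter> Q \<in> unit_nhds" using PQ by (auto simp: unit_nhds_def)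
    fix g
    show "m g ` (P \<inter> Q) \<inter> K = {} \<or> m g ` (P \<inter> Q) \<inter> L = {}"
    proof (rule ccontr)
      assume "\<not> ?thesis"
      then obtain v w where vw: "v \<in> P \<inter> Q" "m g v \<in> K" "w \<in> P \<inter> Q" "m g w \<in> L" by auto
      have "m (i v) w = m (i (m g v)) (m g w)" by (simp add: inverse_distrib_swap assoc)
      then have "m (i v) w \<in> C" using vw unfolding C_def by (intro image_eqI[of _ _ "(m g v, m g w)"]) auto
      moreover have "(v, w) \<in> D" using PQ(4) vw by auto
      ultimately show False by (simp add: D_def)
    qed
  qed
qed

text \<open>The filter along which U shrinks to \<open>e\<close>; the covering ratios are studied
  along it.\<close>

definition small_nhds :: "'a set filter" where
  "small_nhds = (INF V\<in>unit_nhds. principal {U \<in> unit_nhds. U \<subseteq> V})"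

lemma eventually_small_nhds:
  "eventually P small_nhds \<longleftrightarrow> (\<exists>V\<in>unit_nhds. \<forall>U\<in>unit_nhds. U \<subseteq> V \<longrightarrow> P U)"
proof -
  have "unit_nhds \<noteq> {}" by (auto simp: unit_nhds_def intro: exI[of _ UNIV])
  moreover have "\<exists>V\<in>unit_nhds. principal {U \<in> unit_nhds. U \<subseteq> V}
      \<le> inf (principal {U \<in> unit_nhds. U \<subseteq> A}) (principal {U \<in> unit_nhds. U \<subseteq> B})"
    if "A \<in> unit_nhds" "B \<in> unit_nhds" for A B
    using that by (intro bexI[of _ "A \<inter> B"]) (auto simp: unit_nhds_def)
  ultimately have "eventually P small_nhds \<longleftrightarrow>
      (\<exists>V\<in>unit_nhds. eventually P (principal {U \<in> unit_nhds. U \<subseteq> V}))"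
    unfolding small_nhds_def by (rule eventually_INF_base)
  then show ?thesis by (simp add: eventually_principal imp_conjL Ball_def)
qed

lemma small_nhds_neq_bot: "small_nhds \<noteq> bot"
proof
  assume "small_nhds = bot"
  then have "eventually (\<lambda>_. False) small_nhds" by simp
  then show False by (auto simp: eventually_small_nhds)
qed

lemma eventually_unit_nhds: "eventually (\<lambda>U. U \<in> unit_nhds) small_nhds"
  by (auto simp: eventually_small_nhds unit_nhds_def intro!: exI[of _ UNIV])

end

subsection \<open>Haar measure\<close>

text \<open>This takes the place of passing to the limit: the covering ratios are only given a
  cluster point, and it inherits closed conditions.\<close>

lemma cluster_point_in_closed:
  assumes "inf (nhds x) F \<noteq> bot" "closed T" "eventually (\<lambda>y. y \<in> T) F"
  shows "x \<in> T"
proof (rule ccontr)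
  assume "x \<notin> T"
  then have "eventually (\<lambda>y. y \<in> - T) (nhds x)" using assms(2) by (intro eventually_nhds_in_open) auto
  then have "eventually (\<lambda>_. False) (inf (nhds x) F)"
    using assms(3) unfolding eventually_inf by auto
  then show False using assms(1) by (simp add: eventually_False)
qed

locale locally_compact_polish_group = polish_topological_group m i e
  for m :: "'a::topological_space \<Rightarrow> 'a \<Rightarrow> 'a" and i :: "'a \<Rightarrow> 'a" and e :: 'a +
  assumes locally_compact: "locally_compact_space (euclidean :: 'a topology)"
begin

text \<open>By local compactness the basic open sets that lie in some compact set still cover the
  space; one compact superset is chosen for each.\<close>

lemma countable_compact_cover:
  "\<exists>\<K>. countable \<K> \<and> (\<forall>K\<in>\<K>. compact K) \<and> \<Union>\<K> = (UNIV :: 'a set)"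
proof -
  obtain \<B> :: "'a set set" where B: "countable \<B>" "\<forall>V\<in>\<B>. open V"
      "\<forall>U x. open U \<longrightarrow> x \<in> U \<longrightarrow> (\<exists>V\<in>\<B>. x \<in> V \<and> V \<subseteq> U)"
    using second_countable_euclideanD[OF second_countable] by (elim exE conjE) (rule that)
  define \<B>' where "\<B>' = {V \<in> \<B>. \<exists>K. compact K \<and> V \<subseteq> K}"
  define k where "k V = (SOME K. compact K \<and> V \<subseteq> K)" for V :: "'a set"
  have k: "compact (k V) \<and> V \<subseteq> k V" if "V \<in> \<B>'" for V
    using that unfolding k_def \<B>'_def by (intro someI_ex[of "\<lambda>K. compact K \<and> V \<subseteq> K"]) auto
  show ?thesis
  proof (intro exI conjI ballI)
    show "countable (k ` \<B>')" using B(1) by (auto simp: \<B>'_def)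
    show "compact K" if "K \<in> k ` \<B>'" for K using that k by auto
    have "x \<in> \<Union> (k ` \<B>')" for x
    proof -
      obtain U K where "open U" "compact K" "x \<in> U" "U \<subseteq> K"
        using locally_compact unfolding locally_compact_space_def
        by (metis UNIV_I compactin_euclidean_iff open_openin topspace_euclidean)
      then obtain V where "V \<in> \<B>" "x \<in> V" "V \<subseteq> K" using B(3) by (meson subset_trans)
      then have "V \<in> \<B>'" using \<open>compact K\<close> by (auto simp: \<B>'_def)
      with k \<open>x \<in> V\<close> show ?thesis by auto
    qed
    then show "\<Union> (k ` \<B>') = UNIV" by auto
  qed
qed

section \<open>Null sets of left Haar measures: inversion, uniqueness and translation\<close>

lemma left_haar_sigma_finite:
  assumes "left_haar_measure m l" shows "sigma_finite_measure l"
proof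
  obtain \<K> :: "'a set set" where K: "countable \<K>" "\<forall>K\<in>\<K>. compact K" "\<Union>\<K> = UNIV"
    using countable_compact_cover by (elim exE conjE) (rule that)
  have s: "sets l = sets borel" using assms by (simp add: left_haar_measure_def)
  have "\<K> \<subseteq> sets l" using K(2) compact_closed by (auto simp: s)
  moreover have "space l = UNIV" using sets_eq_imp_space_eq[OF s] by simp
  moreover have "emeasure l a \<noteq> \<infinity>" if "a \<in> \<K>" for a
    using K(2) that assms by (auto simp: left_haar_measure_def less_top)
  ultimately show "\<exists>A. countable A \<and> A \<subseteq> sets l \<and> \<Union> A = space l \<and> (\<forall>a\<in>A. emeasure l a \<noteq> \<infinity>)"
    using K by auto
qed

lemma left_haar_nonzero: "left_haar_measure m l \<Longrightarrow> emeasure l UNIV \<noteq> 0"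
  unfolding left_haar_measure_def by blast

lemma left_haar_translate:
  "left_haar_measure m l \<Longrightarrow> A \<in> sets borel \<Longrightarrow> emeasure l (m g ` A) = emeasure l A"
  unfolding left_haar_measure_def by blast

text \<open>Allowing two different measures serves two ends: \<open>l = k\<close> gives invariance
  of null sets under inversion, and inverting twice gives their independence of the chosen
  measure.\<close>

lemma left_haar_null_inverse:
  assumes l: "left_haar_measure m l" and k: "left_haar_measure m k"
    and A [measurable]: "A \<in> sets borel" and 0: "emeasure l A = 0"
  shows "emeasure k (i -` A) = 0"
proof -
  have [measurable_cong]: "sets l = sets borel" "sets k = sets borel"
    using l k by (simp_all add: left_haar_measure_def)
  interpret l: sigma_finite_measure l by (rule left_haar_sigma_finite[OF l])
  interpret k: sigma_finite_measure k by (rule left_haar_sigma_finite[OF k])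
  interpret pair_sigma_finite l k ..
  have sp: "space l = UNIV" "space k = UNIV"
    using sets_eq_imp_space_eq[of l borel] sets_eq_imp_space_eq[of k borel] l k
    by (simp_all add: left_haar_measure_def)
  \<comment> \<open>The sections of \<open>S\<close> are \<open>g A\<close> and \<open>x A\<^sup>-\<^sup>1\<close>, so Fubini gives \<open>l(G) k(A\<^sup>-\<^sup>1) = 0\<close>.\<close>
  define S where "S = {p. m (i (snd p)) (fst p) \<in> A}"
  have "{p \<in> space (l \<Otimes>\<^sub>M k). m (i (snd p)) (fst p) \<in> A} \<in> sets (l \<Otimes>\<^sub>M k)"
    by measurable
  then have S: "S \<in> sets (l \<Otimes>\<^sub>M k)" by (simp add: S_def space_pair_measure sp)
  have iA: "i -` A \<in> sets borel" using measurable_sets[OF measurable_inverse A] by simp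
  have "(\<integral>\<^sup>+x. emeasure k (Pair x -` S) \<partial>l) = (\<integral>\<^sup>+g. emeasure l ((\<lambda>x. (x, g)) -` S) \<partial>k)"
    using k.emeasure_pair_measure_alt[OF S] emeasure_pair_measure_alt2[OF S] by simp
  moreover have "emeasure k (Pair x -` S) = emeasure k (i -` A)" for x
  proof -
    have "Pair x -` S = m x ` (i -` A)"
      by (auto simp: S_def image_mult inverse_distrib_swap)
    then show ?thesis using left_haar_translate[OF k iA] by simp
  qed
  moreover have "emeasure l ((\<lambda>x. (x, g)) -` S) = 0" for g
  proof -
    have "(\<lambda>x. (x, g)) -` S = m g ` A" by (auto simp: S_def image_mult)
    then show ?thesis using left_haar_translate[OF l A] 0 by simp
  qed
  ultimately have "emeasure k (i -` A) * emeasure l UNIV = 0"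
    by (simp only: nn_integral_const sp mult_zero_left)
  then show ?thesis using left_haar_nonzero[OF l] by (simp only: mult_eq_0_iff simp_thms)
qed

lemma left_haar_null_unique:
  assumes "left_haar_measure m l" "left_haar_measure m k" "A \<in> sets borel" "emeasure l A = 0"
  shows "emeasure k A = 0"
proof -
  have "emeasure k (i -` A) = 0" by (rule left_haar_null_inverse[OF assms])
  moreover have "i -` A \<in> sets borel" using measurable_sets[OF measurable_inverse assms(3)] by simp
  ultimately have "emeasure k (i -` i -` A) = 0"
    using left_haar_null_inverse[OF assms(2,2)] by blast
  then show ?thesis by (simp add: vimage_def)
qed

text \<open>Right translation is left translation conjugated by inversion, C y = (y^-1 C^-1)^-1, and
  both operations preserve null sets even if \<open>l\<close> is not right invariant.\<close>

lemma left_haar_null_translate: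
  assumes l: "left_haar_measure m l" and A: "A \<in> sets borel" "emeasure l A = 0"
  shows "emeasure l ((\<lambda>z. m (m x z) y) ` A) = 0"
proof -
  have meas: "i -` C \<in> sets borel" if "C \<in> sets borel" for C
    using measurable_sets[OF measurable_inverse that] by simp
  have inv: "emeasure l (m g ` C) = 0" if "C \<in> sets borel" "emeasure l C = 0" for g C
    using left_haar_translate[OF l] that by simp
  let ?A = "m x ` A"
  have 1: "emeasure l (i -` ?A) = 0" "i -` ?A \<in> sets borel"
    using left_haar_null_inverse[OF l l borel_image_mult[OF A(1)] inv[OF A]]
      meas[OF borel_image_mult[OF A(1)]] by blast+
  then have "emeasure l (m (i y) ` (i -` ?A)) = 0" using inv by blast
  then have "emeasure l (i -` (m (i y) ` (i -` ?A))) = 0"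
    by (rule left_haar_null_inverse[OF l l borel_image_mult[OF 1(2)]])
  also have "i -` (m (i y) ` (i -` ?A)) = (\<lambda>z. m (m x z) y) ` A"
    unfolding image_mult image_mult_mult by (auto simp: inverse_distrib_swap assoc)
  finally show ?thesis .
qed

section \<open>Existence of a left Haar measure\<close>

lemma haar_content_exists:
  obtains c :: "'a set \<Rightarrow> ennreal" and C where "compact_content c" "compact C" "c C \<noteq> 0"
    "\<And>K. compact K \<Longrightarrow> c K < \<infinity>" "\<And>K g. compact K \<Longrightarrow> c (m g ` K) = c K"
proof -
  obtain W C where W: "W \<in> unit_nhds" and C: "compact C" "W \<subseteq> C"
    using locally_compact unfolding locally_compact_space_def unit_nhds_def
    by (metis UNIV_I compactin_euclidean_iff open_openin topspace_euclidean mem_Collect_eq)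
  have "C \<noteq> {}" using W C(2) by (auto simp: unit_nhds_def)
  \<comment> \<open>Each \<open>h U\<close> is to be a point of a product indexed by all sets K, so
    it gets the value 0 at the noncompact ones. C normalises; W provides the bound
    \<open>b K\<close>.\<close>
  define h where "h U K = (if compact K then real (cover_number K U) / real (cover_number C U) else 0)"
    for U K
  define b where "b K = real (cover_number K W)" for K
  have pos: "real (cover_number C U) > 0" if "U \<in> unit_nhds" for U
    using cover_number_pos[OF C(1) that \<open>C \<noteq> {}\<close>] by simp
  \<comment> \<open>A box of compact intervals, compact by Tychonoff; by
    \<open>cover_number_mult\<close> it contains every \<open>h U\<close>.\<close>
  define S where "S = (\<Pi>\<^sub>E K\<in>UNIV. {0..b K})"
  have "compact S"
  proof -
    have "compactin (product_topology (\<lambda>_. euclidean :: real topology) (UNIV :: 'a set set)) S"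
      unfolding S_def by (subst compactin_PiE) auto
    then show ?thesis by (simp add: euclidean_product_topology)
  qed
  have hS: "h U \<in> S" if U: "U \<in> unit_nhds" for U
  proof -
    have "h U K \<in> {0..b K}" for K
    proof (cases "compact K")
      case True
      have "real (cover_number K U) \<le> b K * real (cover_number C U)"
        unfolding b_def of_nat_mult[symmetric] of_nat_le_iff by (rule cover_number_mult[OF True C(1) W C(2) U])
      then show ?thesis using True pos[OF U] by (simp add: h_def divide_le_eq)
    qed (simp add: h_def b_def)
    then show ?thesis by (simp add: S_def PiE_UNIV_domain)
  qed
  define F where "F = filtermap h small_nhds"
  have "F \<noteq> bot" using small_nhds_neq_bot by (simp add: F_def filtermap_bot_iff)
  moreover have "eventually (\<lambda>f. f \<in> S) F"
    unfolding F_def eventually_filtermap using eventually_unit_nhds by (rule eventually_mono) (rule hS)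
  ultimately obtain f where f: "f \<in> S" "inf (nhds f) F \<noteq> bot"
    using \<open>compact S\<close> unfolding compact_filter by blast
  \<comment> \<open>A closed condition that holds for \<open>h U\<close> for all sufficiently small
    U passes to the cluster point \<open>f\<close>.\<close>
  have lim: "P f" if "closed {f. P f}" "\<And>U. U \<in> unit_nhds \<Longrightarrow> U \<subseteq> V \<Longrightarrow> P (h U)" "V \<in> unit_nhds" for P V
  proof -
    have "eventually (\<lambda>f. f \<in> {f. P f}) F"
      unfolding F_def eventually_filtermap eventually_small_nhds using that(2,3) by blast
    from cluster_point_in_closed[OF f(2) that(1) this] show ?thesis by simp
  qed
  have f0: "f K \<ge> 0" for K using f(1) by (auto simp: S_def)
  \<comment> \<open>The bound V to use in \<open>lim\<close> when the condition holds for every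
    U.\<close>
  have fin: "UNIV \<in> unit_nhds" by (simp add: unit_nhds_def)
  note cont = continuous_on_product_coordinates continuous_on_add continuous_on_const
  have empty: "f {} = 0"
    by (rule lim[OF _ _ fin]) (auto intro!: closed_Collect_eq cont simp: h_def cover_number_empty)
  \<comment> \<open>The ratio at C is always 1, so the content obtained is not zero.\<close>
  have one: "f C = 1"
    by (rule lim[OF _ _ fin]) (use pos C in \<open>auto intro!: closed_Collect_eq cont simp: h_def\<close>)
  have mono: "f K \<le> f L" if KL: "compact K" "compact L" "K \<subseteq> L" for K L
  proof (rule lim[OF _ _ fin])
    show "h U K \<le> h U L" if "U \<in> unit_nhds" for U
      using KL cover_number_mono[OF KL(2,3) that] by (simp add: h_def divide_right_mono)
  qed (intro closed_Collect_le cont)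
  have sub: "f (K \<union> L) \<le> f K + f L" if KL: "compact K" "compact L" for K L
  proof (rule lim[OF _ _ fin])
    show "h U (K \<union> L) \<le> h U K + h U L" if "U \<in> unit_nhds" for U
    proof -
      have "real (cover_number (K \<union> L) U) \<le> real (cover_number K U) + real (cover_number L U)"
        using cover_number_Un[OF KL that] by linarith
      then show ?thesis using KL
        by (simp add: h_def compact_Un add_divide_distrib[symmetric] divide_right_mono)
    qed
  qed (intro closed_Collect_le cont)
  have sup: "f K + f L \<le> f (K \<union> L)" if KL: "compact K" "compact L" "K \<inter> L = {}" for K L
  proof -
    \<comment> \<open>Unlike the other conditions, this one holds only for U inside a neighbourhood
      depending on K and L.\<close>
    obtain V where V: "V \<in> unit_nhds" "\<And>g. m g ` V \<inter> K = {} \<or> m g ` V \<inter> L = {}"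
      using separating_unit_nhd[OF KL] by metis
    show ?thesis
    proof (rule lim[OF _ _ V(1)])
      show "h U K + h U L \<le> h U (K \<union> L)" if U: "U \<in> unit_nhds" "U \<subseteq> V" for U
      proof -
        have "m g ` U \<inter> K = {} \<or> m g ` U \<inter> L = {}" for g using V(2)[of g] U(2) by blast
        from cover_number_separated[OF KL(1,2) U(1) this]
        have "real (cover_number K U) + real (cover_number L U) \<le> real (cover_number (K \<union> L) U)"
          by linarith
        then show ?thesis using KL
          by (simp add: h_def compact_Un add_divide_distrib[symmetric] divide_right_mono)
      qed
    qed (intro closed_Collect_le cont)
  qed
  have inv: "f (m g ` K) = f K" if "compact K" for g K
  proof (rule lim[OF _ _ fin])
    show "h U (m g ` K) = h U K" if "U \<in> unit_nhds" for U
      using \<open>compact K\<close> by (simp add: h_def compact_translate cover_number_translate that)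
  qed (intro closed_Collect_eq cont)
  show thesis
  proof (rule that)
    show "compact_content (\<lambda>K. ennreal (f K))"
      using Hausdorff by unfold_locales
        (auto simp: empty mono sub sup f0 ennreal_plus[symmetric] simp del: ennreal_plus intro!: ennreal_leI)
    show "compact C" by (rule C(1))
    show "ennreal (f C) \<noteq> 0" by (simp add: one)
  qed (auto simp: inv)
qed

theorem left_haar_exists: "\<exists>l. left_haar_measure m l"
proof -
  obtain c :: "'a set \<Rightarrow> ennreal" and C where c: "compact_content c" "compact C" "c C \<noteq> 0"
    "\<And>K. compact K \<Longrightarrow> c K < \<infinity>" and inv: "\<And>K g. compact K \<Longrightarrow> c (m g ` K) = c K"
    using haar_content_exists by metis
  interpret compact_content c by fact
  let ?M = content_measure
  \<comment> \<open>Each point has an open neighbourhood U inside a compact L, and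
    \<open>inner U\<close> is at most \<open>c L\<close>, which is finite. Finitely many such U
    cover K.\<close>
  have "outer K < \<infinity>" if K: "compact K" for K
  proof -
    have "\<exists>U. open U \<and> x \<in> U \<and> outer U < \<infinity>" for x
    proof -
      obtain U L where U: "open U" "compact L" "x \<in> U" "U \<subseteq> L"
        using locally_compact unfolding locally_compact_space_def
        by (metis UNIV_I compactin_euclidean_iff open_openin topspace_euclidean)
      have "inner U \<le> c L"
        by (rule inner_least) (use U in \<open>auto intro: content_mono\<close>)
      then show ?thesis using U c(4)[of L] outer_open[of U] by (auto intro: le_less_trans)
    qed
    then obtain U where U: "\<And>x. open (U x)" "\<And>x. x \<in> U x" "\<And>x. outer (U x) < \<infinity>" by metis
    have "K \<subseteq> (\<Union>x\<in>K. U x)" using U(2) by auto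
    then obtain F where "F \<subseteq> K" and F: "finite F" "K \<subseteq> (\<Union>x\<in>F. U x)"
      by (rule compactE_image[OF K U(1)])
    have "outer (\<Union>x\<in>F. U x) < \<infinity>" using F(1)
    proof induction
      case empty then show ?case by (simp add: outer_open inner_empty)
    next
      case (insert x F)
      have "outer (\<Union>x\<in>insert x F. U x) \<le> outer (U x) + outer (\<Union>x\<in>F. U x)" using outer_Un by simp
      also have "\<dots> < \<infinity>" using insert.IH U(3) by (simp add: ennreal_add_eq_top less_top)
      finally show ?case .
    qed
    then show ?thesis using outer_mono[OF F(2)] by (rule le_less_trans[rotated])
  qed
  note outer_compact = this
  have "left_haar_measure m ?M"
    unfolding left_haar_measure_def
  proof (intro conjI allI impI ballI sets_content_measure)
    show "emeasure ?M K < \<infinity>" if "compact K" for K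
      using that outer_compact[OF that] by (simp add: emeasure_content_measure compact_is_closed)
    show "emeasure ?M A = (INF U\<in>{U. open U \<and> A \<subseteq> U}. emeasure ?M U)" if "A \<in> sets borel" for A
    proof -
      have "emeasure ?M A = outer A" using that by (rule emeasure_content_measure)
      also have "\<dots> = (INF U\<in>{U. open U \<and> A \<subseteq> U}. emeasure ?M U)"
        unfolding outer_def[of A] by (intro INF_cong refl) (simp add: emeasure_content_measure outer_open)
      finally show ?thesis .
    qed
    show "emeasure ?M U = (SUP K\<in>{K. compact K \<and> K \<subseteq> U}. emeasure ?M K)" if U: "open U" for U
    proof (rule antisym)
      have "emeasure ?M U = inner U" using U by (simp add: emeasure_content_measure outer_open)
      also have "\<dots> \<le> (SUP K\<in>{K. compact K \<and> K \<subseteq> U}. emeasure ?M K)"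
        unfolding inner_def
        by (intro SUP_mono) (auto simp: emeasure_content_measure compact_is_closed intro!: content_le_outer)
      finally show "emeasure ?M U \<le> \<dots>" .
      show "(SUP K\<in>{K. compact K \<and> K \<subseteq> U}. emeasure ?M K) \<le> emeasure ?M U"
        using U by (intro SUP_least emeasure_mono) auto
    qed
    show "emeasure ?M UNIV \<noteq> 0"
      using content_le_inner[OF c(2), of UNIV] c(3) by (auto simp: emeasure_content_measure outer_open)
    show "emeasure ?M (m g ` A) = emeasure ?M A" if A: "A \<in> sets borel" for g A
    proof -
      \<comment> \<open>Inequalities suffice: applied to \<open>g\<close> and to \<open>i g\<close>
        they give equality.\<close>
      have inner_le: "inner (m g ` U) \<le> inner U" for g U
      proof (rule inner_least)
        fix K assume K: "compact K" "K \<subseteq> m g ` U"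
        then have "m (i g) ` K \<subseteq> m (i g) ` m g ` U" by (intro image_mono)
        then have "m (i g) ` K \<subseteq> U" by (simp add: image_mult_image)
        then have "c (m (i g) ` K) \<le> inner U" using K by (intro content_le_inner compact_translate)
        then show "c K \<le> inner U" using K by (simp add: inv)
      qed
      have outer_le: "outer (m g ` A) \<le> outer A" for g A
      proof (rule outer_greatest)
        fix U assume U: "open U" "A \<subseteq> U"
        then have "outer (m g ` A) \<le> inner (m g ` U)" by (intro outer_le open_translate image_mono)
        also have "\<dots> \<le> inner U" by (rule inner_le)
        finally show "outer (m g ` A) \<le> inner U" .
      qed
      have "outer A = outer (m (i g) ` m g ` A)" by (simp add: image_mult_image)
      then have "outer (m g ` A) = outer A" using outer_le[of g A] outer_le[of "i g" "m g ` A"] by simp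
      then show ?thesis using A by (simp add: emeasure_content_measure)
    qed
  qed
  then show ?thesis by blast
qed

end

subsection \<open>Haar null sets in products\<close>

lemma image_prod_mult:
  assumes "polish_topological_group mG iG eG" "polish_topological_group mH iH eH"
  shows "(u, v) \<in> (\<lambda>z. prod_mult mG mH (prod_mult mG mH (x, h) z) (y, k)) ` B \<longleftrightarrow>
    (mG (mG (iG x) u) (iG y), mH (mH (iH h) v) (iH k)) \<in> B"
proof -
  interpret G: polish_topological_group mG iG eG by fact
  interpret H: polish_topological_group mH iH eH by fact
  show ?thesis (is "_ \<longleftrightarrow> ?w \<in> B")
  proof
    assume "?w \<in> B"
    then have "prod_mult mG mH (prod_mult mG mH (x, h) ?w) (y, k)
      \<in> (\<lambda>z. prod_mult mG mH (prod_mult mG mH (x, h) z) (y, k)) ` B"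
      by (rule imageI)
    then show "(u, v) \<in> (\<lambda>z. prod_mult mG mH (prod_mult mG mH (x, h) z) (y, k)) ` B"
      by (simp add: prod_mult_def)
  qed (auto simp: prod_mult_def)
qed

text \<open>This is (1) \<Rightarrow> (2), with the product measure as witness.\<close>

lemma (in polish_topological_group) haar_null_prod_of_sections:
  fixes mH :: "'h::topological_space \<Rightarrow> 'h \<Rightarrow> 'h"
  assumes H: "polish_topological_group mH iH eH"
    and B: "B \<in> sets borel" and E: "haar_null mH E"
    and \<mu>: "prob_space \<mu>" "sets \<mu> = sets borel"
    and null: "\<And>h x y. h \<notin> E \<Longrightarrow> emeasure \<mu> ((\<lambda>z. m (m x z) y) ` hsection B h) = 0"
  shows "haar_null (prod_mult m mH) B"
proof -
  interpret H: polish_topological_group mH iH eH by fact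
  obtain E' \<nu> where E': "E' \<in> sets borel" "E \<subseteq> E'" and \<nu>: "prob_space \<nu>" "sets \<nu> = sets borel"
    and E'0: "\<And>x y. emeasure \<nu> ((\<lambda>z. mH (mH x z) y) ` E') = 0"
    using E by (auto simp: haar_null_def)
  note [measurable_cong] = \<mu>(2) \<nu>(2)
  interpret M: prob_space \<mu> by fact
  interpret N: prob_space \<nu> by fact
  interpret pair_prob_space \<mu> \<nu> ..
  have sp: "space \<mu> = UNIV" "space \<nu> = UNIV"
    using sets_eq_imp_space_eq[OF \<mu>(2)] sets_eq_imp_space_eq[OF \<nu>(2)] by simp_all
  have sPB: "sets (borel \<Otimes>\<^sub>M borel) = sets (borel :: ('a \<times> 'h) measure)"
    by (rule sets_borel_pair[OF second_countable H.second_countable])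
  have sP: "sets (\<mu> \<Otimes>\<^sub>M \<nu>) = sets borel"
    using sets_pair_measure_cong[OF \<mu>(2) \<nu>(2)] sPB by simp
  have "emeasure (\<mu> \<Otimes>\<^sub>M \<nu>) ((\<lambda>z. prod_mult m mH (prod_mult m mH p z) q) ` B) = 0" for p q
  proof -
    obtain x h y k where pq: "p = (x, h)" "q = (y, k)" by (metis surj_pair)
    let ?S = "(\<lambda>z. prod_mult m mH (prod_mult m mH p z) q) ` B"
    have eq: "(u, v) \<in> ?S \<longleftrightarrow> (m (m (i x) u) (i y), mH (mH (iH h) v) (iH k)) \<in> B" for u v
      unfolding pq by (rule image_prod_mult[OF polish_topological_group_axioms H])
    have [measurable]: "B \<in> sets (borel \<Otimes>\<^sub>M borel)" using B sPB by simp
    have "{z \<in> space (\<mu> \<Otimes>\<^sub>M \<nu>). (m (m (i x) (fst z)) (i y), mH (mH (iH h) (snd z)) (iH k)) \<in> B} \<in> sets (\<mu> \<Otimes>\<^sub>M \<nu>)"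
      by measurable
    also have "{z \<in> space (\<mu> \<Otimes>\<^sub>M \<nu>). (m (m (i x) (fst z)) (i y), mH (mH (iH h) (snd z)) (iH k)) \<in> B} = ?S"
    proof (rule set_eqI)
      fix w :: "'a \<times> 'h"
      show "w \<in> {z \<in> space (\<mu> \<Otimes>\<^sub>M \<nu>). (m (m (i x) (fst z)) (i y), mH (mH (iH h) (snd z)) (iH k)) \<in> B} \<longleftrightarrow> w \<in> ?S"
        using eq[of "fst w" "snd w"] by (simp add: space_pair_measure sp)
    qed
    finally have S: "?S \<in> sets (\<mu> \<Otimes>\<^sub>M \<nu>)" .
    \<comment> \<open>E itself need not be Borel, so the exceptional set of v is a translate of its
      Borel hull \<open>E'\<close>.\<close>
    let ?E = "(\<lambda>z. mH (mH h z) k) ` E'"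
    have "?E \<in> sets \<nu>"
    proof -
      have "(\<lambda>z. mH (mH (iH h) z) (iH k)) \<in> borel_measurable borel" by measurable
      from measurable_sets[OF this E'(1)] show ?thesis by (simp add: H.image_mult_mult \<nu>(2))
    qed
    then have ae: "AE v in \<nu>. v \<notin> ?E" using E'0 by (intro AE_not_in) auto
    have sec: "emeasure \<mu> ((\<lambda>u. (u, v)) -` ?S) = 0" if "v \<notin> ?E" for v
    proof -
      \<comment> \<open>The section of the translated set at v is a two-sided translate of the
        section of B at \<open>?b\<close>, and \<open>?b\<close> is outside E.\<close>
      let ?b = "mH (mH (iH h) v) (iH k)"
      have "?b \<notin> E" using that E'(2) by (auto simp: H.image_mult_mult)
      then have "emeasure \<mu> ((\<lambda>z. m (m x z) y) ` hsection B ?b) = 0" by (rule null)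
      also have "(\<lambda>z. m (m x z) y) ` hsection B ?b = (\<lambda>u. (u, v)) -` ?S"
        unfolding image_mult_mult by (simp add: vimage_def eq hsection_def)
      finally show ?thesis .
    qed
    have "emeasure (\<mu> \<Otimes>\<^sub>M \<nu>) ?S = (\<integral>\<^sup>+v. emeasure \<mu> ((\<lambda>u. (u, v)) -` ?S) \<partial>\<nu>)"
      by (rule emeasure_pair_measure_alt2[OF S])
    also have "\<dots> = (\<integral>\<^sup>+v. 0 \<partial>\<nu>)"
      using ae by (intro nn_integral_cong_AE) (auto simp: sec)
    finally show ?thesis by simp
  qed
  moreover have "prob_space (\<mu> \<Otimes>\<^sub>M \<nu>)" by (rule P.prob_space_axioms)
  ultimately show ?thesis unfolding haar_null_def using B sP
    by (intro exI[of _ B] exI[of _ "\<mu> \<Otimes>\<^sub>M \<nu>"] conjI allI) auto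
qed

text \<open>This is (2) \<Rightarrow> (3), with the projection of the witness to the second
  factor.\<close>

lemma (in locally_compact_polish_group) haar_null_prod_imp_sections:
  fixes mH :: "'h::topological_space \<Rightarrow> 'h \<Rightarrow> 'h"
  assumes H: "polish_topological_group mH iH eH"
    and l: "left_haar_measure m l"
    and B: "haar_null (prod_mult m mH) B"
  obtains E where "haar_null mH E" "\<And>h. h \<notin> E \<Longrightarrow> haar_measure_zero m (hsection B h)"
proof -
  interpret H: polish_topological_group mH iH eH by fact
  obtain B' \<nu> where B': "B' \<in> sets borel" "B \<subseteq> B'" and \<nu>: "prob_space \<nu>" "sets \<nu> = sets borel"
    and B'0: "\<And>p q. emeasure \<nu> ((\<lambda>z. prod_mult m mH (prod_mult m mH p z) q) ` B') = 0"
    using B by (auto simp: haar_null_def)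
  have sPB: "sets (borel \<Otimes>\<^sub>M borel) = sets (borel :: ('a \<times> 'h) measure)"
    by (rule sets_borel_pair[OF second_countable H.second_countable])
  have [measurable_cong]: "sets l = sets borel" "sets \<nu> = sets (borel \<Otimes>\<^sub>M borel)"
    using l \<nu>(2) sPB by (simp_all add: left_haar_measure_def)
  have [measurable]: "B' \<in> sets (borel \<Otimes>\<^sub>M borel)" using B'(1) sPB by simp
  have sp: "space l = UNIV" "space \<nu> = UNIV"
    using sets_eq_imp_space_eq[of l borel] sets_eq_imp_space_eq[OF \<nu>(2)] l
    by (simp_all add: left_haar_measure_def)
  interpret l: sigma_finite_measure l by (rule left_haar_sigma_finite[OF l])
  interpret N: prob_space \<nu> by fact
  interpret pair_sigma_finite l \<nu> ..
  have sec: "hsection B' h \<in> sets borel" for h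
  proof -
    have "{g \<in> space borel. (g, h) \<in> B'} \<in> sets borel" by measurable
    then show ?thesis by (simp add: hsection_def)
  qed
  \<comment> \<open>E is formed with the hull \<open>B'\<close>, whose translates the witness
    controls; its sections contain those of B.\<close>
  define E where "E = {h. emeasure l (hsection B' h) \<noteq> 0}"
  have E [measurable]: "E \<in> sets borel"
  proof -
    have "{w \<in> space (borel \<Otimes>\<^sub>M l). (snd w, fst w) \<in> B'} \<in> sets (borel \<Otimes>\<^sub>M l)" by measurable
    from l.measurable_emeasure_Pair[OF this]
    have [measurable]: "(\<lambda>h. emeasure l (hsection B' h)) \<in> borel_measurable borel"
      by (simp add: vimage_def hsection_def space_pair_measure sp)
    have "{h \<in> space borel. emeasure l (hsection B' h) \<noteq> 0} \<in> sets borel" by measurable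
    then show ?thesis by (simp add: E_def)
  qed
  have "emeasure (distr \<nu> borel snd) ((\<lambda>z. mH (mH h z) k) ` E) = 0" for h k
  proof -
    define t where "t v = mH (mH (iH h) v) (iH k)" for v
    have [measurable]: "t \<in> borel_measurable borel" unfolding t_def by measurable
    \<comment> \<open>\<open>D\<close> consists of the (g, (u, v)) with u g in the section of
      \<open>B'\<close> at \<open>t v\<close>. Fixing g gives the translate of \<open>B'\<close> by
      \<open>(e, h)\<close> on the left and \<open>(i g, k)\<close> on the right, a null set for
      \<open>\<nu>\<close>. Fixing (u, v) gives the left translate of that section by u^-1, whose
      \<open>l\<close>-measure is that of the section.\<close>
    define D where "D = {w. (m (fst (snd w)) (fst w), t (snd (snd w))) \<in> B'}"
    have "{w \<in> space (l \<Otimes>\<^sub>M \<nu>). (m (fst (snd w)) (fst w), t (snd (snd w))) \<in> B'} \<in> sets (l \<Otimes>\<^sub>M \<nu>)"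
      by measurable
    then have D: "D \<in> sets (l \<Otimes>\<^sub>M \<nu>)" by (simp add: D_def space_pair_measure sp)
    have "emeasure \<nu> (Pair g -` D) = 0" for g
    proof -
      have "Pair g -` D = (\<lambda>z. prod_mult m mH (prod_mult m mH (e, h) z) (i g, k)) ` B'"
        by (rule set_eqI, simp only: split_paired_all image_prod_mult[OF polish_topological_group_axioms H])
          (simp add: D_def t_def)
      then show ?thesis using B'0 by simp
    qed
    then have "emeasure (l \<Otimes>\<^sub>M \<nu>) D = 0"
      by (simp add: N.emeasure_pair_measure_alt[OF D])
    then have "(\<integral>\<^sup>+w. emeasure l ((\<lambda>g. (g, w)) -` D) \<partial>\<nu>) = 0"
      by (simp add: emeasure_pair_measure_alt2[OF D])
    then have "AE w in \<nu>. emeasure l ((\<lambda>g. (g, w)) -` D) = 0"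
      by (simp add: nn_integral_0_iff_AE measurable_emeasure_Pair2[OF D])
    moreover have "emeasure l ((\<lambda>g. (g, w)) -` D) = emeasure l (hsection B' (t (snd w)))" for w
    proof -
      have "(\<lambda>g. (g, w)) -` D = m (i (fst w)) ` hsection B' (t (snd w))"
        by (auto simp: D_def hsection_def image_mult)
      then show ?thesis using left_haar_translate[OF l sec] by simp
    qed
    ultimately have ae: "AE w in \<nu>. t (snd w) \<notin> E" by (simp add: E_def)
    have im: "(\<lambda>z. mH (mH h z) k) ` E = t -` E" unfolding t_def H.image_mult_mult by simp
    have "t -` E \<in> sets borel" using measurable_sets[of t borel borel E] by simp
    then have "emeasure (distr \<nu> borel snd) (t -` E) = emeasure \<nu> {w \<in> space \<nu>. t (snd w) \<in> E}"
      by (subst emeasure_distr) (auto intro!: arg_cong[where f = "emeasure \<nu>"])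
    also have "\<dots> = 0" by (intro AE_iff_measurable[THEN iffD1, OF _ _ ae]) auto
    finally show ?thesis by (simp add: im)
  qed
  moreover have "prob_space (distr \<nu> borel snd)" by (rule N.prob_space_distr) measurable
  ultimately have "haar_null mH E" unfolding haar_null_def using E
    by (intro exI[of _ E] exI[of _ "distr \<nu> borel snd"] conjI) auto
  moreover have "haar_measure_zero m (hsection B h)" if "h \<notin> E" for h
    unfolding haar_measure_zero_def using l sec[of h] that B'(2)
    by (intro exI[of _ l] conjI bexI[of _ "hsection B' h"]) (auto simp: E_def hsection_def)
  ultimately show thesis using that by blast
qed

text \<open>The witness gives the hull measure 0 and the whole space measure 1.\<close>

lemma haar_null_proper:
  assumes "polish_topological_group m i e" "haar_null m E"
  obtains h where "h \<notin> E"
proof -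
  interpret polish_topological_group m i e by fact
  obtain E' \<nu> where E': "E \<subseteq> E'" "prob_space \<nu>" "sets \<nu> = sets borel"
    and 0: "\<And>x y. emeasure \<nu> ((\<lambda>z. m (m x z) y) ` E') = 0"
    using assms(2) by (auto simp: haar_null_def)
  have "emeasure \<nu> E' = 0" using 0[of e e] by simp
  moreover have "emeasure \<nu> UNIV = 1"
    using prob_space.emeasure_space_1[OF E'(2)] sets_eq_imp_space_eq[OF E'(3)] by simp
  ultimately have "E' \<noteq> UNIV" by auto
  then show thesis using E'(1) that by blast
qed

text \<open>This is (3) \<Rightarrow> (1): one measure equivalent to Haar measure on a compact set
  serves all sections and all translates at once.\<close>

lemma (in locally_compact_polish_group) uniform_witness_of_sections:
  fixes mH :: "'h::topological_space \<Rightarrow> 'h \<Rightarrow> 'h"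
  assumes H: "polish_topological_group mH iH eH"
    and B: "B \<in> sets borel" and E: "haar_null mH E"
    and zero: "\<And>h. h \<notin> E \<Longrightarrow> haar_measure_zero m (hsection B h)"
  obtains \<mu> where "prob_space \<mu>" "sets \<mu> = sets borel"
    "\<And>h x y. h \<notin> E \<Longrightarrow> emeasure \<mu> ((\<lambda>z. m (m x z) y) ` hsection B h) = 0"
proof -
  interpret H: polish_topological_group mH iH eH by fact
  \<comment> \<open>Some h lies outside E, and the hypothesis at that h supplies a left Haar
    measure.\<close>
  obtain l where l: "left_haar_measure m l"
    using haar_null_proper[OF H E] zero by (metis haar_measure_zero_def)
  note l_def = l[unfolded left_haar_measure_def]
  have sets_l: "sets l = sets borel" and fin: "\<And>K. compact K \<Longrightarrow> emeasure l K < \<infinity>"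
    using l_def by simp_all
  have inner: "emeasure l UNIV = (SUP K\<in>{K. compact K \<and> K \<subseteq> UNIV}. emeasure l K)"
    using l_def[THEN conjunct2, THEN conjunct2, THEN conjunct2, THEN conjunct1] by blast
  \<comment> \<open>Inner regularity of the whole space: if all compact sets were null,
    \<open>l\<close> would vanish. Compactness also makes the measure of K finite, so it can be
    normalised.\<close>
  have "\<exists>K. compact K \<and> emeasure l K \<noteq> 0"
  proof (rule ccontr)
    assume "\<not> ?thesis"
    then have "emeasure l K = 0" if "compact K" for K using that by blast
    then have "emeasure l UNIV \<le> 0" unfolding inner by (intro SUP_least) auto
    then show False using left_haar_nonzero[OF l] by simp
  qed
  then obtain K where K: "compact K" "emeasure l K \<noteq> 0" by blast
  have K': "K \<in> sets l" using K(1) compact_closed by (simp add: sets_l)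
  define \<mu> where "\<mu> = uniform_measure l K"
  have "prob_space \<mu>" unfolding \<mu>_def using K fin[OF K(1)] by (intro prob_space_uniform_measure) auto
  moreover have "sets \<mu> = sets borel" by (simp add: \<mu>_def sets_l)
  moreover have "emeasure \<mu> ((\<lambda>z. m (m x z) y) ` hsection B h) = 0" if h: "h \<notin> E" for h x y
  proof -
    let ?S = "(\<lambda>z. m (m x z) y) ` hsection B h"
    have [measurable]: "B \<in> sets (borel \<Otimes>\<^sub>M borel)"
      using B sets_borel_pair[OF second_countable H.second_countable] by simp
    have "{g \<in> space borel. (g, h) \<in> B} \<in> sets borel" by measurable
    then have sec: "hsection B h \<in> sets borel" by (simp add: hsection_def)
    have "(\<lambda>z. m (m (i x) z) (i y)) \<in> borel_measurable borel" by measurable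
    from measurable_sets[OF this sec] have S: "?S \<in> sets l" by (simp add: image_mult_mult sets_l)
    \<comment> \<open>The Haar measure \<open>k\<close> may depend on h; uniqueness of null sets
      transfers the conclusion to the fixed \<open>l\<close>.\<close>
    obtain k N where k: "left_haar_measure m k" "N \<in> sets borel" "hsection B h \<subseteq> N" "emeasure k N = 0"
      using zero[OF h] by (auto simp: haar_measure_zero_def)
    have "emeasure l N = 0" by (rule left_haar_null_unique[OF k(1) l k(2,4)])
    then have "emeasure l (hsection B h) = 0"
      using emeasure_mono[OF k(3), of l] k(2) sets_l by simp
    then have "emeasure l ?S = 0" by (rule left_haar_null_translate[OF l sec])
    then have "emeasure l (K \<inter> ?S) = 0"
      using emeasure_mono[of "K \<inter> ?S" ?S l] S by simp
    then show ?thesis using K' S by (simp add: \<mu>_def)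
  qed
  ultimately show thesis by (rule that)
qed

theorem theorem5p4:
  fixes mG :: "'g::topological_space \<Rightarrow> 'g \<Rightarrow> 'g" and iG :: "'g \<Rightarrow> 'g" and eG :: 'g
    and mH :: "'h::topological_space \<Rightarrow> 'h \<Rightarrow> 'h" and iH :: "'h \<Rightarrow> 'h" and eH :: 'h
    and B :: "('g \<times> 'h) set"
  assumes G: "polish_group mG iG eG"
    and H: "polish_group mH iH eH"
    and B: "B \<in> sets borel"
  defines "C1 \<equiv> (\<exists>E. haar_null mH E \<and>
                    (\<exists>\<mu>. prob_space \<mu> \<and> sets \<mu> = sets borel \<and>
                       (\<forall>h. h \<notin> E \<longrightarrow> (\<forall>g1 g2.
                          emeasure \<mu> ((\<lambda>z. mG (mG g1 z) g2) ` hsection B h) = 0))))"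
    and "C2 \<equiv> haar_null (prod_mult mG mH) B"
    and "C3 \<equiv> (\<exists>E. haar_null mH E \<and>
                    (\<forall>h. h \<notin> E \<longrightarrow> haar_measure_zero mG (hsection B h)))"
  shows "(C1 \<longrightarrow> C2) \<and>
         (locally_compact_space (euclidean :: 'g topology) \<longrightarrow> (C1 \<longleftrightarrow> C2) \<and> (C2 \<longleftrightarrow> C3))"
proof -
  interpret G: polish_topological_group mG iG eG by unfold_locales (rule G)
  have H': "polish_topological_group mH iH eH" by unfold_locales (rule H)
  have 12: "C1 \<longrightarrow> C2"
    unfolding C1_def C2_def using G.haar_null_prod_of_sections[OF H' B] by blast
  have "(C1 \<longleftrightarrow> C2) \<and> (C2 \<longleftrightarrow> C3)" if "locally_compact_space (euclidean :: 'g topology)"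
  proof -
    interpret G: locally_compact_polish_group mG iG eG by unfold_locales (rule that)
    \<comment> \<open>Condition (2) mentions no Haar measure, so one has to be constructed before
      (3) can be derived from it.\<close>
    obtain l where l: "left_haar_measure mG l" using G.left_haar_exists by blast
    have "C2 \<longrightarrow> C3"
      unfolding C2_def C3_def using G.haar_null_prod_imp_sections[OF H' l, of B] by metis
    moreover have "C3 \<longrightarrow> C1"
    proof
      assume C3
      then obtain E where E: "haar_null mH E" "\<And>h. h \<notin> E \<Longrightarrow> haar_measure_zero mG (hsection B h)"
        unfolding C3_def by blast
      obtain \<mu> where "prob_space \<mu>" "sets \<mu> = sets borel"
        "\<And>h x y. h \<notin> E \<Longrightarrow> emeasure \<mu> ((\<lambda>z. mG (mG x z) y) ` hsection B h) = 0"
        using G.uniform_witness_of_sections[OF H' B E] by metis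
      then show C1 unfolding C1_def using E(1) by (intro exI[of _ E] exI[of _ \<mu>] conjI) simp_all
    qed
    ultimately show ?thesis using 12 by blast
  qed
  with 12 show ?thesis by blast
qed

end
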